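(* Let $a,b$ be positive integers and let $z\in D$. Then $$\mathop{\rm Li}\nolimits_{a,b}(z)=(-1)^b\sum_{k=1}^{a}\binom{a+b-k-1}{b-1}\mathop{\rm Li}\nolimits_{k,a+b-k}(z)+\sum_{k=1}^{b}(-1)^{b-k}\binom{a+b-k-1}{a-1}\mathop{\rm Li}\nolimits_k(z)\,\mathop{\rm Li}\nolimits_{a+b-k}(z).$$
   Context: For positive integers $s_1,\dots,s_l$ the generalized polylogarithm is $\mathop{\rm Li}\nolimits_{s_1,\dots,s_l}(z)=\sum_{n_1>n_2>\dots>n_l\ge1}\frac{z^{n_1}}{n_1^{s_1}\cdots n_l^{s_l}}$ for $|z|<1$; in particular $\mathop{\rm Li}\nolimits_k(z)=\sum_{n\ge1}z^n/n^k$. These functions extend analytically to the domain $D=\mathbb{C}\setminus[1,+\infty)$ (the complex plane cut along the real axis from $1$ to $+\infty$), and $\mathop{\rm Li}\nolimits_{\vec s}(z)$ for $z\in D$ denotes this continuation. *)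

theory Defs
  imports "HOL-Complex_Analysis.Complex_Analysis"
begin

definition cut_plane :: "complex set" where
  "cut_plane = UNIV - complex_of_real ` {1..}"

definition multi_indices :: "nat \<Rightarrow> nat list set" where
  "multi_indices l = {ns. length ns = l \<and> sorted_wrt (>) ns \<and> (\<forall>n\<in>set ns. n \<ge> 1)}"

text \<open>
  The exponent \<open>s\<close> is meant to be a nonempty list of positive integers. For \<open>norm z < 1\<close> the
  series converges absolutely, so the unordered sum is the usual one; \<open>hd ns\<close> is the
  largest summation index.
\<close>
definition Li_series :: "nat list \<Rightarrow> complex \<Rightarrow> complex" where
  "Li_series s z =
     (\<Sum>\<^sub>\<infinity>ns\<in>multi_indices (length s). z ^ hd ns / (\<Prod>i<length s. of_nat (ns ! i) ^ (s ! i)))"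

definition Li_continuation :: "nat list \<Rightarrow> (complex \<Rightarrow> complex) \<Rightarrow> bool" where
  "Li_continuation s f \<longleftrightarrow>
     f holomorphic_on cut_plane \<and> (\<forall>z\<in>ball 0 1. f z = Li_series s z)"

text \<open>
  By the lemma \<open>Li_eqI\<close> below, the choice made here has no influence on the values in the
  cut plane; values on the cut are meaningless.
\<close>
definition Li :: "nat list \<Rightarrow> complex \<Rightarrow> complex" where
  "Li s = (SOME f. Li_continuation s f)"

lemma open_cut_plane: "open cut_plane"
proof -
  have "complex_of_real ` {1..} = {z. Im z = 0} \<inter> {z. Re z \<ge> 1}"
    by (auto simp: complex_eq_iff image_iff)
  moreover have "closed ({z. Im z = 0} \<inter> {z. Re z \<ge> 1})"
    by (intro closed_Int closed_halfspace_Im_eq closed_halfspace_Re_ge)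
  ultimately show ?thesis
    by (simp add: cut_plane_def open_Diff)
qed

lemma ball_subset_cut_plane: "ball 0 1 \<subseteq> cut_plane"
  by (auto simp: cut_plane_def)

lemma starlike_cut_plane: "starlike cut_plane"
  unfolding starlike_def
proof (intro bexI[of _ 0] ballI subsetI)
  fix x y assume x: "x \<in> cut_plane" and "y \<in> closed_segment 0 x"
  then obtain u where u: "0 \<le> u" "u \<le> 1" "y = of_real u * x"
    by (auto simp: closed_segment_def scaleR_conv_of_real)
  show "y \<in> cut_plane"
  proof (rule ccontr)
    assume "y \<notin> cut_plane"
    then obtain t where t: "t \<ge> 1" "y = of_real t" by (auto simp: cut_plane_def)
    with u have "u \<noteq> 0" by auto
    with t u have "x = of_real (t / u)" by (simp add: field_simps)
    moreover have "t / u \<ge> 1" using t u \<open>u \<noteq> 0\<close> by simp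
    ultimately show False using x unfolding cut_plane_def by blast
  qed
qed (auto simp: cut_plane_def)

lemma Li_eqI:
  assumes f: "Li_continuation s f" and z: "z \<in> cut_plane"
  shows "Li s z = f z"
proof -
  have Li: "Li_continuation s (Li s)"
    unfolding Li_def by (rule someI[of "Li_continuation s", OF f])
  show ?thesis
  proof (rule analytic_continuation_open[where s = "ball 0 1" and s' = cut_plane and f = "Li s" and g = f])
    show "connected cut_plane"
      by (simp add: starlike_cut_plane starlike_imp_connected)
    show "Li s w = f w" if "w \<in> ball 0 1" for w
      using that Li f by (simp add: Li_continuation_def)
    show "Li s holomorphic_on cut_plane" "f holomorphic_on cut_plane"
      using Li f by (simp_all add: Li_continuation_def)
  qed (use z ball_subset_cut_plane in \<open>simp_all add: open_cut_plane\<close>)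
qed

end

theory Submission
  imports Defs
begin

text \<open>
  Write the summation indices of \<open>Li\<^sub>a\<^sub>,\<^sub>b\<close> as \<open>n + m > n\<close>. Inside the unit disc the relation then holds
  term by term, by the partial fraction decomposition of \<open>1 / ((n + m)^a * n^b)\<close> with the difference
  \<open>m\<close> of the two factors held fixed. The identity theorem carries it to the cut plane, once the
  continuations are known to exist: power series that continue to the cut plane are closed under
  taking partial sums of the coefficients (multiply by \<open>z / (1 - z)\<close>) and under dividing the
  \<open>n\<close>-th coefficient by \<open>n\<close> (take a primitive of \<open>f z / z\<close>).
\<close>

section \<open>Partial fractions\<close>

text \<open>The hypothesis is the relation between \<open>x = 1 / (n + m)\<close>,
  \<open>y = 1 / n\<close> and \<open>w = 1 / m\<close>, which keeps the argument free of division.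
  Replacing mixed products \<open>x * y\<close> by it separates the powers of \<open>x\<close> (the
  sum \<open>A\<close>) from those of \<open>y\<close> (the sum \<open>B\<close>); the inductions
  multiply by one factor \<open>x\<close> or \<open>y\<close> at a time.\<close>

lemma prod_power_partial_fraction:
  fixes x y w :: "'a :: comm_ring_1"
  assumes xy: "x * y = w * (y - x)"
  shows "x ^ Suc a * y ^ Suc b =
      (-1) ^ Suc b * (\<Sum>i\<le>a. of_nat ((i + b) choose b) * x ^ Suc (a - i) * w ^ (i + b + 1))
    + (\<Sum>i\<le>b. (-1) ^ i * of_nat ((i + a) choose a) * y ^ Suc (b - i) * w ^ (i + a + 1))"
proof -
  define A where "A a b = (\<Sum>i\<le>a. of_nat ((i + b) choose b) * x ^ Suc (a - i) * w ^ (i + b + 1))" for a b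
  define B where "B a b = (\<Sum>i\<le>b. (-1) ^ i * of_nat ((i + a) choose a) * y ^ Suc (b - i) * w ^ (i + a + 1))" for a b
  have A_Suc: "A (Suc a) b = x * A a b + of_nat ((a + b + 1) choose b) * x * w ^ (a + b + 2)" for a b
    by (simp add: A_def sum_distrib_left Suc_diff_le algebra_simps)
  have B_Suc: "B a (Suc b) = y * B a b + (-1) ^ Suc b * of_nat ((a + b + 1) choose a) * y * w ^ (a + b + 2)" for a b
    by (simp add: B_def sum_distrib_left Suc_diff_le algebra_simps)
  \<comment> \<open>The remainder left by multiplying \<open>B a b\<close> by \<open>x\<close> is a
    single monomial in \<open>x\<close> and \<open>w\<close>. Up to the sign
    \<open>(-1) ^ Suc b\<close> it is the term by which \<open>A (Suc a) b\<close> exceeds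
    \<open>x * A a b\<close>.\<close>
  have xB: "x * B a b = B (Suc a) b + (-1) ^ Suc b * of_nat ((a + b + 1) choose b) * x * w ^ (a + b + 2)" for a b
  proof (induction b)
    case 0
    have "x * B a 0 = (x * y) * w ^ (a + 1)" by (simp add: B_def algebra_simps)
    also have "\<dots> = B (Suc a) 0 + (-1) ^ Suc 0 * of_nat ((a + 0 + 1) choose 0) * x * w ^ (a + 0 + 2)"
      unfolding xy by (simp add: B_def algebra_simps)
    finally show ?case .
  next
    case (Suc b)
    have sym: "((a + b + 1) choose b) = ((a + b + 1) choose Suc a)"
              "((a + Suc b + 1) choose Suc b) = ((a + Suc b + 1) choose Suc a)"
      by (subst binomial_symmetric; simp)+
    \<comment> \<open>The product \<open>x * y\<close> arises twice: from the remainder in the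
      induction hypothesis, multiplied by \<open>y\<close>, and from the last term of
      \<open>B a (Suc b)\<close>. Pascal's rule adds the two coefficients once both are written with
      lower index \<open>a\<close> or \<open>Suc a\<close>.\<close>
    have pascal: "((a + Suc b + 1) choose Suc a) = ((a + b + 1) choose a) + ((a + b + 1) choose Suc a)"
      by simp
    have "x * B a (Suc b) = y * (x * B a b) + (-1) ^ Suc b * of_nat ((a + b + 1) choose a) * (x * y) * w ^ (a + b + 2)"
      unfolding B_Suc by (simp add: algebra_simps)
    also have "\<dots> = y * B (Suc a) b
        + (-1) ^ Suc b * of_nat ((a + Suc b + 1) choose Suc a) * (x * y) * w ^ (a + b + 2)"
      unfolding Suc.IH pascal sym of_nat_add by (simp add: algebra_simps)
    also have "\<dots> = B (Suc a) (Suc b)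
        + (-1) ^ Suc (Suc b) * of_nat ((a + Suc b + 1) choose Suc b) * x * w ^ (a + Suc b + 2)"
      unfolding B_Suc xy sym by (simp add: algebra_simps)
    finally show ?case .
  qed
  have base: "x * y ^ Suc b = (-1) ^ Suc b * A 0 b + B 0 b" for b
  proof (induction b)
    case 0
    show ?case using xy by (simp add: A_def B_def algebra_simps)
  next
    case (Suc b)
    have A0: "A 0 b = x * w ^ (b + 1)" for b by (simp add: A_def)
    have "x * y ^ Suc (Suc b) = y * (x * y ^ Suc b)" by (simp add: algebra_simps)
    also have "\<dots> = (-1) ^ Suc b * (x * y) * w ^ (b + 1) + y * B 0 b"
      unfolding Suc.IH A0 by (simp add: algebra_simps)
    also have "\<dots> = (-1) ^ Suc (Suc b) * A 0 (Suc b) + B 0 (Suc b)"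
      unfolding B_Suc xy A0 by (simp add: algebra_simps)
    finally show ?case .
  qed
  have "x ^ Suc a * y ^ Suc b = (-1) ^ Suc b * A a b + B a b"
  proof (induction a)
    case 0
    show ?case using base[of b] by simp
  next
    case (Suc a)
    have "x ^ Suc (Suc a) * y ^ Suc b = x * (x ^ Suc a * y ^ Suc b)" by (simp add: algebra_simps)
    also have "\<dots> = (-1) ^ Suc b * (x * A a b) + x * B a b"
      unfolding Suc.IH by (simp add: algebra_simps)
    also have "\<dots> = (-1) ^ Suc b * A (Suc a) b + B (Suc a) b"
      unfolding xB A_Suc by (simp add: algebra_simps)
    finally show ?case .
  qed
  then show ?thesis by (simp add: A_def B_def)
qed

lemma partial_fraction:
  fixes n m :: "'a :: field"
  assumes nz: "n \<noteq> 0" "m \<noteq> 0" "n + m \<noteq> 0" and ab: "a \<ge> 1" "b \<ge> 1"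
  shows "1 / ((n + m) ^ a * n ^ b) =
      (-1) ^ b * (\<Sum>k=1..a. of_nat ((a + b - k - 1) choose (b - 1)) * (1 / ((n + m) ^ k * m ^ (a + b - k))))
    + (\<Sum>k=1..b. (-1) ^ (b - k) * of_nat ((a + b - k - 1) choose (a - 1)) * (1 / (n ^ k * m ^ (a + b - k))))"
proof -
  obtain a' b' where a': "a = Suc a'" and b': "b = Suc b'"
    using ab by (metis One_nat_def Suc_le_D)
  define x y w where "x = 1 / (n + m)" and "y = 1 / n" and "w = 1 / m"
  have "x * y = w * (y - x)"
    using nz by (simp add: x_def y_def w_def divide_simps)
  note prod_power_partial_fraction[OF this, of a' b']
  \<comment> \<open>With \<open>k = a - i\<close> the exponent \<open>Suc (a' - i)\<close> becomes
    \<open>k\<close>, and \<open>i + b' + 1\<close> becomes \<open>a + b - k\<close>.\<close>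
  also have "(\<Sum>i\<le>a'. of_nat ((i + b') choose b') * x ^ Suc (a' - i) * w ^ (i + b' + 1)) =
      (\<Sum>k=1..a. of_nat ((a + b - k - 1) choose (b - 1)) * (x ^ k * w ^ (a + b - k)))"
    by (rule sum.reindex_bij_witness[of _ "\<lambda>k. a - k" "\<lambda>i. a - i"])
       (auto simp: a' b' Suc_diff_le mult.assoc add.commute)
  also have "(\<Sum>i\<le>b'. (-1) ^ i * of_nat ((i + a') choose a') * y ^ Suc (b' - i) * w ^ (i + a' + 1)) =
      (\<Sum>k=1..b. (-1) ^ (b - k) * of_nat ((a + b - k - 1) choose (a - 1)) * (y ^ k * w ^ (a + b - k)))"
    by (rule sum.reindex_bij_witness[of _ "\<lambda>k. b - k" "\<lambda>i. b - i"])
       (auto simp: a' b' Suc_diff_le mult.assoc add.commute)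
  finally show ?thesis
    by (simp add: x_def y_def w_def a' b' power_one_over divide_simps)
qed

section \<open>Double series in the unit disc\<close>

text \<open>This is the common majorant of all double series below. Its sum over \<open>m\<close> is
  a constant multiple of \<open>r ^ n\<close>, hence again geometric.\<close>

lemma geometric_product_abs_summable:
  fixes z :: "'a :: real_normed_field"
  assumes "norm z < 1"
  shows "(\<lambda>(n, m). z ^ (n + m)) abs_summable_on {1..} \<times> {1..}"
proof -
  define r where "r = norm z"
  have r: "norm r < 1" "r \<ge> 0" using assms by (auto simp: r_def)
  have "(\<lambda>(n, m). r ^ (n + m)) summable_on {1..} \<times> {1..}"
  proof (rule summable_on_SigmaI[where g = "\<lambda>n. r ^ n * (r / (1 - r))"])
    show "((\<lambda>m. case (n, m) of (n, m) \<Rightarrow> r ^ (n + m)) has_sum r ^ n * (r / (1 - r))) {1..}" for n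
      using has_sum_cmult_right[OF has_sum_geometric_from_1[OF r(1)], of "r ^ n"]
      by (simp add: power_add)
    show "(\<lambda>n. r ^ n * (r / (1 - r))) summable_on {1..}"
      using has_sum_cmult_left[OF has_sum_geometric_from_1[OF r(1)]] by (rule has_sum_imp_summable)
  qed (use r in auto)
  moreover have "(\<lambda>p. norm (case p of (n, m) \<Rightarrow> z ^ (n + m))) = (\<lambda>(n, m). r ^ (n + m))"
    by (auto simp: r_def norm_power)
  ultimately show ?thesis by simp
qed

lemma weighted_geometric_summable:
  fixes z :: "'a :: {real_normed_field, banach}" and c :: "nat \<Rightarrow> nat \<Rightarrow> 'a"
  assumes "norm z < 1" and c: "\<And>n m. n \<ge> 1 \<Longrightarrow> m \<ge> 1 \<Longrightarrow> norm (c n m) \<le> 1"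
  shows "(\<lambda>(n, m). z ^ (n + m) * c n m) summable_on {1..} \<times> {1..}"
proof (rule abs_summable_summable, rule Infinite_Sum.abs_summable_on_comparison_test[OF geometric_product_abs_summable[OF assms(1)]])
  show "norm (case p of (n, m) \<Rightarrow> z ^ (n + m) * c n m) \<le> norm (case p of (n, m) \<Rightarrow> z ^ (n + m))"
    if "p \<in> {1..} \<times> {1..}" for p
    using that by (auto simp: norm_mult intro!: mult_left_le c)
qed

lemma norm_inverse_power_le_1: "n \<ge> 1 \<Longrightarrow> norm (1 / (of_nat n :: complex) ^ k) \<le> 1"
  by (simp add: norm_divide norm_power divide_le_eq_1)

lemma norm_inverse_powers_le_1:
  "n \<ge> 1 \<Longrightarrow> m \<ge> 1 \<Longrightarrow> norm (1 / ((of_nat n :: complex) ^ k * of_nat m ^ l)) \<le> 1"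
  using mult_le_one[OF norm_inverse_power_le_1 norm_ge_zero norm_inverse_power_le_1, of n m k l]
  by (simp flip: norm_mult)

lemma Li_series_1: "Li_series [k] z = (\<Sum>\<^sub>\<infinity>n\<in>{1..}. z ^ n * (1 / of_nat n ^ k))"
proof -
  have "bij_betw (\<lambda>n. [n]) {1..} (multi_indices 1)"
    by (rule bij_betw_byWitness[where f' = hd]) (auto simp: multi_indices_def length_Suc_conv)
  from infsum_reindex_bij_betw[OF this, of "\<lambda>ns. z ^ hd ns / of_nat (ns ! 0) ^ k"] show ?thesis
    by (simp add: Li_series_def)
qed

text \<open>A decreasing pair of indices is encoded by its smaller entry \<open>n\<close> and the
  gap \<open>m\<close>. The index set becomes a full product, the same one that occurs when two
  single series are multiplied.\<close>

lemma Li_series_2: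
  "Li_series [a, b] z = (\<Sum>\<^sub>\<infinity>(n, m)\<in>{1..}\<times>{1..}. z ^ (n + m) * (1 / (of_nat (n + m) ^ a * of_nat n ^ b)))"
proof -
  have "bij_betw (\<lambda>(n, m). [n + m, n]) ({1..} \<times> {1..}) (multi_indices 2)"
    by (rule bij_betw_byWitness[where f' = "\<lambda>ns. (ns ! 1, ns ! 0 - ns ! 1)"])
       (auto simp: multi_indices_def numeral_2_eq_2 length_Suc_conv)
  from infsum_reindex_bij_betw[OF this, of "\<lambda>ns. z ^ hd ns / (of_nat (ns ! 0) ^ a * of_nat (ns ! 1) ^ b)"]
  show ?thesis
    by (simp add: Li_series_def numeral_2_eq_2 lessThan_Suc case_prod_unfold mult.commute)
qed

text \<open>Partial fractions produce denominators in \<open>n + m\<close> and \<open>m\<close>.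
  Exchanging the two summation variables, which leaves \<open>n + m\<close> fixed, identifies these
  as double polylogarithms too.\<close>

lemma Li_series_2_swap:
  "Li_series [a, b] z = (\<Sum>\<^sub>\<infinity>(n, m)\<in>{1..}\<times>{1..}. z ^ (n + m) * (1 / (of_nat (n + m) ^ a * of_nat m ^ b)))"
proof -
  have "bij_betw (\<lambda>(n, m). (m, n)) ({1..} \<times> {1..}) ({1..} \<times> {1::nat..})"
    by (rule bij_betw_byWitness[where f' = "\<lambda>(n, m). (m, n)"]) auto
  from infsum_reindex_bij_betw[OF this,
      of "\<lambda>(n, m). z ^ (n + m) * (1 / (of_nat (n + m) ^ a * of_nat n ^ b))"]
  show ?thesis
    by (simp add: Li_series_2 case_prod_unfold add.commute)
qed

lemma Li_series_summable_2:
  assumes "norm z < 1"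
  shows "(\<lambda>(n, m). z ^ (n + m) * (1 / (of_nat (n + m) ^ a * of_nat n ^ b :: complex))) summable_on {1..} \<times> {1..}"
  by (rule weighted_geometric_summable[OF assms norm_inverse_powers_le_1]) auto

lemma Li_series_summable_2_swap:
  assumes "norm z < 1"
  shows "(\<lambda>(n, m). z ^ (n + m) * (1 / (of_nat (n + m) ^ a * of_nat m ^ b :: complex))) summable_on {1..} \<times> {1..}"
  by (rule weighted_geometric_summable[OF assms norm_inverse_powers_le_1]) auto

lemma Li_series_summable_prod:
  assumes "norm z < 1"
  shows "(\<lambda>(n, m). z ^ (n + m) * (1 / (of_nat n ^ a * of_nat m ^ b :: complex))) summable_on {1..} \<times> {1..}"
  by (rule weighted_geometric_summable[OF assms norm_inverse_powers_le_1]) auto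

lemma Li_series_prod:
  assumes "norm z < 1"
  shows "Li_series [a] z * Li_series [b] z =
    (\<Sum>\<^sub>\<infinity>(n, m)\<in>{1..}\<times>{1..}. z ^ (n + m) * (1 / (of_nat n ^ a * of_nat m ^ b)))"
proof -
  have "(\<Sum>\<^sub>\<infinity>(n, m)\<in>{1..}\<times>{1..}. z ^ (n + m) * (1 / (of_nat n ^ a * of_nat m ^ b))) =
     (\<Sum>\<^sub>\<infinity>n\<in>{1..}. \<Sum>\<^sub>\<infinity>m\<in>{1..}. z ^ (n + m) * (1 / (of_nat n ^ a * of_nat m ^ b)))"
    using infsum_Sigma_banach[OF Li_series_summable_prod[OF assms, of a b]] by simp
  also have "\<dots> = (\<Sum>\<^sub>\<infinity>n\<in>{1..}. \<Sum>\<^sub>\<infinity>m\<in>{1..}. (z ^ n * (1 / of_nat n ^ a)) * (z ^ m * (1 / of_nat m ^ b)))"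
    by (simp add: power_add mult_ac)
  also have "\<dots> = Li_series [a] z * Li_series [b] z"
    by (simp only: infsum_cmult_right' infsum_cmult_left' Li_series_1)
  finally show ?thesis ..
qed

lemma has_sum_finite_sum:
  fixes f :: "'i \<Rightarrow> 'a \<Rightarrow> 'b :: topological_comm_monoid_add"
  assumes "\<And>i. i \<in> I \<Longrightarrow> (f i has_sum s i) A"
  shows "((\<lambda>x. \<Sum>i\<in>I. f i x) has_sum (\<Sum>i\<in>I. s i)) A"
  using assms by (induction I rule: infinite_finite_induct) (auto intro: has_sum_add)

text \<open>Every series involved runs over the same pairs and carries the same factor
  \<open>z ^ (n + m)\<close>, so only the coefficients have to be compared, and this is
  \<open>partial_fraction\<close>. Unordered summability permits adding the series term by
  term.\<close>

lemma Li_series_relation: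
  assumes z: "norm z < 1" and ab: "a \<ge> 1" "b \<ge> 1"
  shows "Li_series [a, b] z =
    (-1) ^ b * (\<Sum>k=1..a. of_nat ((a + b - k - 1) choose (b - 1)) * Li_series [k, a + b - k] z)
    + (\<Sum>k=1..b. (-1) ^ (b - k) * of_nat ((a + b - k - 1) choose (a - 1))
                   * (Li_series [k] z * Li_series [a + b - k] z))"
proof -
  define P :: "(nat \<times> nat) set" where "P = {1..} \<times> {1..}"
  define T where "T k l = (\<lambda>(n, m). z ^ (n + m) * (1 / (of_nat (n + m) ^ k * of_nat m ^ l)))" for k l
  define U where "U k l = (\<lambda>(n, m). z ^ (n + m) * (1 / (of_nat n ^ k * of_nat m ^ l)))" for k l
  have T: "(T k l has_sum Li_series [k, l] z) P" for k l
    unfolding T_def P_def Li_series_2_swap by (intro has_sum_infsum Li_series_summable_2_swap z)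
  have U: "(U k l has_sum Li_series [k] z * Li_series [l] z) P" for k l
    unfolding U_def P_def Li_series_prod[OF z] by (intro has_sum_infsum Li_series_summable_prod z)
  have "((\<lambda>p. (-1) ^ b * (\<Sum>k=1..a. of_nat ((a + b - k - 1) choose (b - 1)) * T k (a + b - k) p)
    + (\<Sum>k=1..b. (-1) ^ (b - k) * of_nat ((a + b - k - 1) choose (a - 1)) * U k (a + b - k) p)) has_sum
    ((-1) ^ b * (\<Sum>k=1..a. of_nat ((a + b - k - 1) choose (b - 1)) * Li_series [k, a + b - k] z)
    + (\<Sum>k=1..b. (-1) ^ (b - k) * of_nat ((a + b - k - 1) choose (a - 1))
                   * (Li_series [k] z * Li_series [a + b - k] z)))) P" (is "(?f has_sum ?S) P")
    by (intro has_sum_add has_sum_cmult_right has_sum_finite_sum T U)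
  moreover have "?f (n, m) = z ^ (n + m) * (1 / (of_nat (n + m) ^ a * of_nat n ^ b))"
    if "(n, m) \<in> P" for n m
  proof -
    have nz: "of_nat n \<noteq> (0 :: complex)" "of_nat m \<noteq> (0 :: complex)" "of_nat n + of_nat m \<noteq> (0 :: complex)"
      using that by (auto simp: P_def simp flip: of_nat_add)
    show ?thesis
      unfolding T_def U_def prod.case of_nat_add partial_fraction[OF nz ab]
      by (simp add: distrib_left sum_distrib_left mult_ac)
  qed
  ultimately have "((\<lambda>(n, m). z ^ (n + m) * (1 / (of_nat (n + m) ^ a * of_nat n ^ b))) has_sum ?S) P"
    by (subst has_sum_cong[of _ _ ?f]) auto
  then show ?thesis
    unfolding Li_series_2 P_def by (rule infsumI)
qed

section \<open>Power series that continue to the cut plane\<close>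

text \<open>Thus \<open>c\<close> is the sequence of Taylor coefficients of \<open>f\<close> at 0.
  Allowing arbitrary coefficients covers the intermediate functions met while building up the
  exponents.\<close>

definition powser_continuation :: "(nat \<Rightarrow> complex) \<Rightarrow> (complex \<Rightarrow> complex) \<Rightarrow> bool" where
  "powser_continuation c f \<longleftrightarrow>
     f holomorphic_on cut_plane \<and> (\<forall>z\<in>ball 0 1. (\<lambda>n. c n * z ^ n) sums f z)"

text \<open>This is the starting point, the polylogarithm of order 0. Its vanishing constant
  coefficient is what makes division by the index possible.\<close>

lemma powser_continuation_geometric:
  "powser_continuation (\<lambda>n. if n = 0 then 0 else 1) (\<lambda>z. z / (1 - z))"
  unfolding powser_continuation_def
proof (intro conjI ballI)
  have "1 \<notin> cut_plane" unfolding cut_plane_def by (auto intro: image_eqI[of _ _ 1])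
  then show "(\<lambda>z. z / (1 - z)) holomorphic_on cut_plane"
    by (intro holomorphic_intros) auto
  show "(\<lambda>n. (if n = 0 then 0 else 1) * z ^ n) sums (z / (1 - z))" if "z \<in> ball 0 1" for z :: complex
  proof -
    have "(\<lambda>n. z * z ^ n) sums (z * (1 / (1 - z)))"
      by (rule sums_mult, rule geometric_sums) (use that in simp)
    then show ?thesis
      using sums_Suc_iff[of "\<lambda>n. (if n = 0 then 0 else 1) * z ^ n" "z / (1 - z)"] by simp
  qed
qed

text \<open>The series converges at a real point \<open>r\<close> strictly between
  \<open>norm z\<close> and 1, which forces absolute convergence at \<open>z\<close>.\<close>

lemma powser_continuation_abs_summable:
  assumes "powser_continuation c f" and "norm z < 1"
  shows "summable (\<lambda>n. norm (c n * z ^ n))"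
proof -
  obtain r where r: "norm z < r" "r < 1" using assms(2) dense by blast
  then have "0 < r" using norm_ge_zero le_less_trans by blast
  show ?thesis
  proof (rule powser_insidea[where x = "of_real r"])
    show "summable (\<lambda>n. c n * of_real r ^ n)"
      using assms(1) r \<open>0 < r\<close> by (auto simp: powser_continuation_def intro: sums_summable)
  qed (use r \<open>0 < r\<close> in simp)
qed

text \<open>This is a Cauchy product with \<open>z / (1 - z)\<close>. The numerator \<open>z\<close>
  shifts by one, so the partial sums run over \<open>i < n\<close>, matching the strict inequality
  between summation indices.\<close>

lemma powser_continuation_partial_sums:
  assumes f: "powser_continuation c f"
  shows "powser_continuation (\<lambda>n. \<Sum>i<n. c i) (\<lambda>z. f z * (z / (1 - z)))"
  unfolding powser_continuation_def
proof (intro conjI ballI)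
  note geom = powser_continuation_geometric
  show "(\<lambda>z. f z * (z / (1 - z))) holomorphic_on cut_plane"
    using f geom unfolding powser_continuation_def by (intro holomorphic_on_mult) auto
  fix z :: complex assume "z \<in> ball 0 1"
  then have z: "norm z < 1" by simp
  let ?e = "\<lambda>n::nat. if n = 0 then 0 else 1 :: complex"
  have "(\<lambda>k. \<Sum>i\<le>k. (c i * z ^ i) * (?e (k - i) * z ^ (k - i))) sums
          ((\<Sum>k. c k * z ^ k) * (\<Sum>k. ?e k * z ^ k))"
    by (intro Cauchy_product_sums powser_continuation_abs_summable[OF f z]
          powser_continuation_abs_summable[OF geom z])
  also have "(\<lambda>k. \<Sum>i\<le>k. (c i * z ^ i) * (?e (k - i) * z ^ (k - i))) = (\<lambda>k. (\<Sum>i<k. c i) * z ^ k)"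
  proof
    fix k
    \<comment> \<open>The term \<open>i = k\<close> drops out because
      \<open>?e 0 = 0\<close>.\<close>
    have "(\<Sum>i\<le>k. (c i * z ^ i) * (?e (k - i) * z ^ (k - i))) = (\<Sum>i<k. (c i * z ^ i) * (?e (k - i) * z ^ (k - i)))"
      by (simp flip: lessThan_Suc_atMost)
    also have "\<dots> = (\<Sum>i<k. c i * z ^ k)"
      by (intro sum.cong) (auto simp flip: power_add)
    finally show "(\<Sum>i\<le>k. (c i * z ^ i) * (?e (k - i) * z ^ (k - i))) = (\<Sum>i<k. c i) * z ^ k"
      by (simp add: sum_distrib_right)
  qed
  also have "(\<Sum>k. c k * z ^ k) = f z"
    using f z by (auto simp: powser_continuation_def sums_iff)
  also have "(\<Sum>k. ?e k * z ^ k) = z / (1 - z)"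
    using geom z unfolding powser_continuation_def sums_iff by auto
  finally show "(\<lambda>n. (\<Sum>i<n. c i) * z ^ n) sums (f z * (z / (1 - z)))" .
qed

text \<open>Dividing coefficients by the index inverts the operator \<open>z * d/dz\<close>. Since
  \<open>c 0 = 0\<close>, the singularity of \<open>f z / z\<close> at 0 is removable, and a
  primitive exists because the cut plane is starlike.\<close>

lemma powser_continuation_divide_index:
  assumes f: "powser_continuation c f" and c0: "c 0 = 0"
  shows "\<exists>g. powser_continuation (\<lambda>n. c n / of_nat n) g"
proof -
  define h where "h z = (if z = 0 then c 1 else f z / z)" for z
  have h_sums: "(\<lambda>n. c (Suc n) * z ^ n) sums h z" if "norm z < 1" for z
  proof (cases "z = 0")
    case True
    then show ?thesis using powser_sums_zero[of "\<lambda>n. c (Suc n)"] by (simp add: h_def)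
  next
    case False
    have "(\<lambda>n. c n * z ^ n) sums f z"
      using f that by (auto simp: powser_continuation_def)
    then have "(\<lambda>n. c (Suc n) * z ^ Suc n) sums f z"
      by (subst sums_Suc_iff) (simp add: c0)
    from sums_divide[OF this, of z] show ?thesis using False by (simp add: h_def)
  qed
  \<comment> \<open>Holomorphy is glued from two open sets: near 0 it comes from the power series,
    away from 0 from the quotient.\<close>
  have "h holomorphic_on ball 0 1"
    by (rule power_series_holomorphic[where a = "\<lambda>n. c (Suc n)"]) (simp add: h_sums)
  moreover have "h holomorphic_on cut_plane - {0}"
  proof (rule holomorphic_transform)
    show "(\<lambda>z. f z / z) holomorphic_on cut_plane - {0}"
      using f by (intro holomorphic_intros) (auto simp: powser_continuation_def intro: holomorphic_on_subset)
  qed (simp add: h_def)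
  ultimately have "h holomorphic_on (ball 0 1 \<union> (cut_plane - {0}))"
    by (intro holomorphic_on_Un) (auto simp: open_cut_plane open_delete)
  also have "ball 0 1 \<union> (cut_plane - {0}) = cut_plane"
    using ball_subset_cut_plane by auto
  finally have h: "h holomorphic_on cut_plane" .
  then obtain G where G: "\<And>z. z \<in> cut_plane \<Longrightarrow> (G has_field_derivative h z) (at z)"
    using holomorphic_starlike_primitive[of cut_plane h "{}"] holomorphic_on_imp_continuous_on
      starlike_cut_plane open_cut_plane holomorphic_on_imp_differentiable_at by (metis Diff_empty finite.emptyI)
  define s where "s z = (\<Sum>n. c n / of_nat n * z ^ n)" for z
  have summ: "summable (\<lambda>n. c n / of_nat n * z ^ n)" if "norm z < 1" for z
  proof (rule summable_comparison_test'[OF powser_continuation_abs_summable[OF f that], of 1])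
    fix n :: nat assume "n \<ge> 1"
    then have "norm (c n) / real n \<le> norm (c n)"
      by (simp add: divide_le_eq mult_le_cancel_left1)
    from mult_right_mono[OF this norm_ge_zero, of "z ^ n"]
    show "norm (c n / of_nat n * z ^ n) \<le> norm (c n * z ^ n)"
      by (simp only: norm_mult norm_divide norm_of_nat)
  qed
  \<comment> \<open>In the disc both the primitive \<open>G\<close> and the desired series
    \<open>s\<close> have derivative \<open>h\<close>. They differ by a constant there, and
    subtracting it from \<open>G\<close> on the whole cut plane gives the continuation of
    \<open>s\<close>.\<close>
  have "((\<lambda>z. G z - s z) has_field_derivative 0) (at z)" if "norm z < 1" for z
  proof -
    have "(s has_field_derivative (\<Sum>n. diffs (\<lambda>n. c n / of_nat n) n * z ^ n)) (at z)"
      unfolding s_def by (rule termdiffs_strong'[OF summ that])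
    also have "(\<Sum>n. diffs (\<lambda>n. c n / of_nat n) n * z ^ n) = h z"
      using h_sums[OF that] by (simp add: diffs_def sums_iff del: of_nat_Suc)
    finally show ?thesis
      using DERIV_diff[OF G, of z s "h z"] that ball_subset_cut_plane by auto
  qed
  then have "\<exists>C. \<forall>z\<in>ball 0 1. G z - s z = C"
    by (rule has_field_derivative_zero_constant[OF convex_ball has_field_derivative_at_within]) simp
  then obtain C where C: "\<And>z. z \<in> ball 0 1 \<Longrightarrow> G z - s z = C"
    by blast
  have "powser_continuation (\<lambda>n. c n / of_nat n) (\<lambda>z. G z - C)"
    unfolding powser_continuation_def
  proof (intro conjI ballI)
    show "(\<lambda>z. G z - C) holomorphic_on cut_plane"
      using G open_cut_plane by (intro holomorphic_intros) (auto simp: holomorphic_on_open)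
    show "(\<lambda>n. c n / of_nat n * z ^ n) sums (G z - C)" if "z \<in> ball 0 1" for z
      using C[OF that] summ[of z] that by (auto simp: s_def sums_iff algebra_simps)
  qed
  then show ?thesis by blast
qed

lemma powser_continuation_divide_index_power:
  assumes "\<exists>f. powser_continuation c f" and "c 0 = 0"
  shows "\<exists>g. powser_continuation (\<lambda>n. c n / of_nat n ^ k) g"
proof (induction k)
  case (Suc k)
  then show ?case
    using powser_continuation_divide_index[of "\<lambda>n. c n / of_nat n ^ k"] assms(2)
    by (auto simp: mult.commute)
qed (use assms in simp)

section \<open>Existence of the continuations\<close>

lemma Li_continuation_exists_1: "\<exists>f. Li_continuation [k] f"
proof -
  let ?c = "\<lambda>n::nat. if n = 0 then 0 else 1 :: complex"
  obtain f where f: "powser_continuation (\<lambda>n. ?c n / of_nat n ^ k) f"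
    using powser_continuation_divide_index_power[of ?c k] powser_continuation_geometric by auto
  have "Li_series [k] z = f z" if z: "z \<in> ball 0 1" for z
  proof -
    \<comment> \<open>Absolute convergence turns the ordered sum into the unordered one used by
      \<open>Li_series\<close>; the index 0 then drops out since \<open>?c 0 = 0\<close>.\<close>
    have "((\<lambda>n. ?c n / of_nat n ^ k * z ^ n) has_sum f z) UNIV"
      by (rule norm_summable_imp_has_sum[OF powser_continuation_abs_summable[OF f]])
         (use f z in \<open>auto simp: powser_continuation_def\<close>)
    also have "?this \<longleftrightarrow> ((\<lambda>n. z ^ n * (1 / of_nat n ^ k)) has_sum f z) {1..}"
      by (rule has_sum_cong_neutral) auto
    finally show ?thesis unfolding Li_series_1 by (rule infsumI)
  qed
  with f have "Li_continuation [k] f"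
    by (auto simp: Li_continuation_def powser_continuation_def)
  then show ?thesis by blast
qed

text \<open>Starting from the geometric series, divide \<open>b\<close> times by the index, take
  partial sums, and divide \<open>a\<close> times. The empty partial sum at index 0 supplies the
  zero constant coefficient for the second round of divisions.\<close>

lemma Li_continuation_exists_2: "\<exists>f. Li_continuation [a, b] f"
proof -
  let ?c = "\<lambda>n::nat. if n = 0 then 0 else 1 :: complex"
  define d where "d n = (\<Sum>i<n. ?c i / of_nat i ^ b) / of_nat n ^ a" for n :: nat
  obtain f where f: "powser_continuation d f"
    using powser_continuation_divide_index_power[of ?c b] powser_continuation_geometric
      powser_continuation_partial_sums[of "\<lambda>i. ?c i / of_nat i ^ b"]
      powser_continuation_divide_index_power[of "\<lambda>n. \<Sum>i<n. ?c i / of_nat i ^ b" a]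
    unfolding d_def by fastforce
  have "Li_series [a, b] z = f z" if z: "z \<in> ball 0 1" for z
  proof -
    let ?t = "\<lambda>(N, n). z ^ N * (1 / (of_nat N ^ a * of_nat n ^ b))"
    \<comment> \<open>Passing from \<open>(n, m)\<close> to \<open>(N, n)\<close> with
      \<open>N = n + m\<close> groups the double series by powers of \<open>z\<close>. For each
      \<open>N\<close> only finitely many \<open>n\<close> remain, and their sum is the coefficient
      \<open>d N\<close>.\<close>
    have "bij_betw (\<lambda>(n, m). (n + m, n)) ({1..} \<times> {1..}) (SIGMA N:UNIV. {1..<N::nat})"
      by (rule bij_betw_byWitness[where f' = "\<lambda>(N, n). (n, N - n)"]) auto
    note bij = has_sum_reindex_bij_betw[OF this, of ?t]
    have "((\<lambda>(n, m). z ^ (n + m) * (1 / (of_nat (n + m) ^ a * of_nat n ^ b))) has_sum Li_series [a, b] z)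
            ({1..} \<times> {1..})"
      unfolding Li_series_2 by (intro has_sum_infsum Li_series_summable_2) (use z in simp)
    then have "(?t has_sum Li_series [a, b] z) (SIGMA N:UNIV. {1..<N})"
      using bij by (simp add: case_prod_unfold)
    then have "((\<lambda>N. \<Sum>n=1..<N. ?t (N, n)) has_sum Li_series [a, b] z) UNIV"
      by (rule has_sum_Sigma') (intro has_sum_finite, simp)
    then have "(\<lambda>N. \<Sum>n=1..<N. ?t (N, n)) sums Li_series [a, b] z"
      by (rule has_sum_imp_sums)
    also have "(\<lambda>N. \<Sum>n=1..<N. ?t (N, n)) = (\<lambda>N. d N * z ^ N)"
    proof
      fix N
      have "(\<Sum>i<N. ?c i / of_nat i ^ b) = (\<Sum>n=1..<N. 1 / of_nat n ^ b)"
        by (rule sum.mono_neutral_cong_right) auto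
      then show "(\<Sum>n=1..<N. ?t (N, n)) = d N * z ^ N"
        by (simp add: d_def sum_distrib_left sum_distrib_right sum_divide_distrib mult_ac)
    qed
    finally have "(\<lambda>N. d N * z ^ N) sums Li_series [a, b] z" .
    moreover have "(\<lambda>N. d N * z ^ N) sums f z"
      using f z by (simp add: powser_continuation_def)
    ultimately show ?thesis by (rule sums_unique2)
  qed
  with f have "Li_continuation [a, b] f"
    by (auto simp: Li_continuation_def powser_continuation_def)
  then show ?thesis by blast
qed

section \<open>Transfer to the cut plane\<close>

lemma Li_continuation_Li: "\<exists>f. Li_continuation s f \<Longrightarrow> Li_continuation s (Li s)"
  unfolding Li_def by (rule someI_ex[of "Li_continuation s"])

theorem theorem3:
  fixes a b :: nat and z :: complex
  assumes "a \<ge> 1" and "b \<ge> 1" and "z \<in> cut_plane"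
  shows "Li [a, b] z =
    (-1) ^ b * (\<Sum>k=1..a. of_nat ((a + b - k - 1) choose (b - 1)) * Li [k, a + b - k] z)
    + (\<Sum>k=1..b. (-1) ^ (b - k) * of_nat ((a + b - k - 1) choose (a - 1))
                   * (Li [k] z * Li [a + b - k] z))"
proof -
  \<comment> \<open>The right-hand side is made a function of \<open>w\<close> because the identity
    theorem compares holomorphic functions on the whole cut plane, starting from their agreement on
    the disc.\<close>
  define R where "R w = (-1) ^ b * (\<Sum>k=1..a. of_nat ((a + b - k - 1) choose (b - 1)) * Li [k, a + b - k] w)
    + (\<Sum>k=1..b. (-1) ^ (b - k) * of_nat ((a + b - k - 1) choose (a - 1))
                   * (Li [k] w * Li [a + b - k] w))" for w
  note Li1 = Li_continuation_Li[OF Li_continuation_exists_1]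
  note Li2 = Li_continuation_Li[OF Li_continuation_exists_2]
  have hol: "Li [k] holomorphic_on cut_plane" "Li [k, l] holomorphic_on cut_plane" for k l
    using Li1 Li2 by (auto simp: Li_continuation_def)
  have "Li [a, b] z = R z"
  proof (rule analytic_continuation_open[where s = "ball 0 1" and s' = cut_plane and f = "Li [a, b]" and g = R])
    show "Li [a, b] holomorphic_on cut_plane" by (rule hol)
    show "R holomorphic_on cut_plane"
      unfolding R_def by (intro holomorphic_intros hol)
    show "connected cut_plane"
      by (simp add: starlike_cut_plane starlike_imp_connected)
    fix w :: complex assume w: "w \<in> ball 0 1"
    then have "Li [k] w = Li_series [k] w" "Li [k, l] w = Li_series [k, l] w" for k l
      using Li1 Li2 by (auto simp: Li_continuation_def)
    with Li_series_relation[of w a b] assms w show "Li [a, b] w = R w"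
      by (simp add: R_def)
  qed (use assms ball_subset_cut_plane in \<open>simp_all add: open_cut_plane\<close>)
  then show ?thesis by (simp only: R_def)
qed

end
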